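(* Let $n>0$ be a real number and $$K_n(x)=\sum_{k=0}^\infty\left(e^{-nx}\frac{(nx)^k}{k!}\right)^2,\quad x\in[0,+\infty).$$ Then for all $x\ge0$: $$xK_n''(x)+(4nx+1)K_n'(x)+2nK_n(x)=0,$$ $$K_n(x)=\frac1\pi\int_{-1}^1e^{-2nx(1+t)}\frac{dt}{\sqrt{1-t^2}},$$ $$K_n(x)\le\frac1{\sqrt{4nx+1}}.$$
   Context: The convention $0^0=1$ is used; derivatives at $x=0$ are one-sided. *)

theory Defs
  imports "HOL-Analysis.Analysis"
begin

definition K :: "real \<Rightarrow> real \<Rightarrow> real" where
  "K n x = (\<Sum>k. (exp (- (n * x)) * ((n * x) ^ k / fact k))\<^sup>2)"

(* The series converges, so its suminf value is meaningful. *)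
lemma summable_K:
  fixes n x :: real
  shows "summable (\<lambda>k. (exp (- (n * x)) * ((n * x) ^ k / fact k))\<^sup>2)"
proof -
  let ?y = "n * x"
  have "summable (\<lambda>k. exp (- ?y) ^ 2 * ((?y ^ 2) ^ k /\<^sub>R fact k))"
    by (intro summable_mult summable_exp_generic)
  moreover have "norm ((exp (- ?y) * (?y ^ k / fact k))\<^sup>2)
      \<le> exp (- ?y) ^ 2 * ((?y ^ 2) ^ k /\<^sub>R fact k)" for k
  proof -
    have "(?y ^ 2) ^ k / (fact k)\<^sup>2 \<le> (?y ^ 2) ^ k / fact k"
      by (intro divide_left_mono) (auto simp: power2_eq_square)
    then have "exp (- ?y) ^ 2 * ((?y ^ 2) ^ k / (fact k)\<^sup>2)
        \<le> exp (- ?y) ^ 2 * ((?y ^ 2) ^ k / fact k)"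
      by (rule mult_left_mono) simp
    moreover have "norm ((exp (- ?y) * (?y ^ k / fact k))\<^sup>2)
        = exp (- ?y) ^ 2 * ((?y ^ 2) ^ k / (fact k)\<^sup>2)"
      unfolding real_norm_def abs_power2
      by (simp only: power_mult_distrib power_divide power_mult [symmetric] mult.commute)
    ultimately show ?thesis
      by (simp add: divide_inverse mult.commute)
  qed
  ultimately show ?thesis
    by (rule summable_comparison_test' [where N = 0])
qed

end

theory Submission
  imports Defs
begin

text \<open>
  With \<open>t = sin \<theta>\<close> and \<open>y = n x\<close> the integral becomes
  \<open>J(y) = \<integral> exp (- 2 y (1 + sin \<theta>)) d\<theta>\<close> over \<open>[- \<pi>/2, \<pi>/2]\<close>. Expanding the exponential and
  inserting the moments of \<open>sin\<close> gives \<open>K n x = J(n x) / \<pi>\<close>. Differentiating under the integral,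
  \<open>y J'' + (4 y + 1) J' + 2 J\<close> is the integral of the derivative of
  \<open>2 cos \<theta> exp (- 2 y (1 + sin \<theta>))\<close>, which vanishes at both ends. Since \<open>J'' \<ge> 0\<close>, this equation
  shows that \<open>sqrt (4 y + 1) J(y)\<close> has derivative \<open>- y J'' / sqrt (4 y + 1) \<le> 0\<close>, whence the bound.
\<close>

section \<open>An integral depending on the parameter \<open>y\<close>, and its derivatives\<close>

definition bessel_integrand :: "nat \<Rightarrow> real \<Rightarrow> real \<Rightarrow> real" where
  "bessel_integrand m y \<theta> = (- 2 * (1 + sin \<theta>)) ^ m * exp (- 2 * y * (1 + sin \<theta>))"

definition bessel_integral :: "nat \<Rightarrow> real \<Rightarrow> real" where
  "bessel_integral m y = integral {- (pi / 2)..pi / 2} (bessel_integrand m y)"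

lemma continuous_on_bessel_integrand: "continuous_on A (bessel_integrand m y)"
  unfolding bessel_integrand_def by (intro continuous_intros)

lemma bessel_integrand_integrable:
  "bessel_integrand m y integrable_on {- (pi / 2)..pi / 2}"
  by (intro integrable_continuous_real continuous_on_bessel_integrand)

lemma bessel_integral_has_integral:
  "(bessel_integrand m y has_integral bessel_integral m y) {- (pi / 2)..pi / 2}"
  unfolding bessel_integral_def
  by (intro integrable_integral bessel_integrand_integrable)

text \<open>The index \<open>m\<close> counts derivatives in \<open>y\<close>: each one brings down
  another factor \<open>- 2 * (1 + sin \<theta>)\<close>. The new integrand is jointly continuous,
  so Leibniz' rule applies for every real \<open>y\<close>.\<close>

lemma DERIV_bessel_integral:
  "(bessel_integral m has_real_derivative bessel_integral (Suc m) y) (at y within A)"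
proof -
  have "((\<lambda>y. integral (cbox (- (pi / 2)) (pi / 2)) (bessel_integrand m y)) has_field_derivative
      integral (cbox (- (pi / 2)) (pi / 2)) (bessel_integrand (Suc m) y)) (at y within UNIV)"
  proof (rule leibniz_rule_field_derivative)
    show "((\<lambda>y. bessel_integrand m y \<theta>) has_field_derivative bessel_integrand (Suc m) y \<theta>)
        (at y within UNIV)" for y \<theta>
      unfolding bessel_integrand_def by (auto intro!: derivative_eq_intros)
    show "continuous_on (UNIV \<times> cbox (- (pi / 2)) (pi / 2))
        (\<lambda>(y, \<theta>). bessel_integrand (Suc m) y \<theta>)"
      unfolding bessel_integrand_def case_prod_beta by (intro continuous_intros)
  qed (auto simp: bessel_integrand_integrable)
  then show ?thesis
    unfolding bessel_integral_def by (auto intro: has_field_derivative_at_within)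
qed

section \<open>Differential equation and upper bound for the integral\<close>

lemma bessel_integral_ode:
  "y * bessel_integral 2 y + (4 * y + 1) * bessel_integral 1 y + 2 * bessel_integral 0 y = 0"
proof -
  let ?I = "{- (pi / 2)..pi / 2}"
  let ?F = "\<lambda>\<theta>. 2 * cos \<theta> * exp (- 2 * y * (1 + sin \<theta>))"
  let ?f = "\<lambda>\<theta>. y * bessel_integrand 2 y \<theta> + (4 * y + 1) * bessel_integrand 1 y \<theta>
    + 2 * bessel_integrand 0 y \<theta>"
  have "(?f has_integral ?F (pi / 2) - ?F (- (pi / 2))) ?I"
  proof (rule fundamental_theorem_of_calculus)
    fix \<theta> :: real
    have "(?F has_real_derivative
        (- 2 * sin \<theta> - 4 * y * (cos \<theta>)\<^sup>2) * exp (- 2 * y * (1 + sin \<theta>))) (at \<theta> within ?I)"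
      by (auto intro!: derivative_eq_intros simp: algebra_simps power2_eq_square)
    \<comment> \<open>With \<open>s = sin \<theta>\<close>, the terms of \<open>?f\<close>
      containing \<open>y\<close> add up to \<open>4 * y * (1 + s) * (s - 1)\<close>, which is
      \<open>- 4 * y\<close> times the squared cosine; the others leave
      \<open>- 2 * s\<close>.\<close>
    moreover have "(- 2 * sin \<theta> - 4 * y * (cos \<theta>)\<^sup>2) * exp (- 2 * y * (1 + sin \<theta>)) = ?f \<theta>"
      unfolding bessel_integrand_def cos_squared_eq
      by (simp add: algebra_simps power2_eq_square)
    ultimately show "(?F has_vector_derivative ?f \<theta>) (at \<theta> within ?I)"
      by (simp add: has_real_derivative_iff_has_vector_derivative)
  qed simp
  moreover have "(?f has_integral
      y * bessel_integral 2 y + (4 * y + 1) * bessel_integral 1 y + 2 * bessel_integral 0 y) ?I"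
    by (intro has_integral_add has_integral_mult_right bessel_integral_has_integral)
  ultimately show ?thesis
    by (simp add: has_integral_iff)
qed

lemma bessel_integral_2_nonneg: "bessel_integral 2 y \<ge> 0"
  unfolding bessel_integral_def
  by (rule integral_nonneg[OF bessel_integrand_integrable]) (simp add: bessel_integrand_def)

lemma bessel_integral_0_0: "bessel_integral 0 0 = pi"
  by (simp add: bessel_integral_def bessel_integrand_def[abs_def])

lemma bessel_integral_le:
  assumes "y \<ge> 0"
  shows "bessel_integral 0 y \<le> pi / sqrt (4 * y + 1)"
proof -
  let ?H = "\<lambda>y. sqrt (4 * y + 1) * bessel_integral 0 y"
  have "?H y \<le> ?H 0"
  proof (rule DERIV_nonpos_imp_nonincreasing[OF assms])
    fix u :: real assume u: "0 \<le> u" "u \<le> y"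
    have pos: "sqrt (4 * u + 1) > 0"
      using u by simp
    have sq: "sqrt (4 * u + 1) * sqrt (4 * u + 1) = 4 * u + 1"
      using u by simp
    have "(?H has_real_derivative
        2 / sqrt (4 * u + 1) * bessel_integral 0 u + sqrt (4 * u + 1) * bessel_integral 1 u) (at u)"
      using u DERIV_bessel_integral[of 0 u]
      by (auto intro!: derivative_eq_intros simp: field_simps)
    \<comment> \<open>Over the common denominator, the numerator is the left side of the
      differential equation without its second-order term, hence equal to
      \<open>- (u * bessel_integral 2 u)\<close>.\<close>
    moreover have "2 / sqrt (4 * u + 1) * bessel_integral 0 u + sqrt (4 * u + 1) * bessel_integral 1 u
        = (2 * bessel_integral 0 u + (4 * u + 1) * bessel_integral 1 u) / sqrt (4 * u + 1)"
      unfolding add_divide_distrib using pos sq by (simp add: eq_divide_eq mult_ac)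
    moreover have "2 * bessel_integral 0 u + (4 * u + 1) * bessel_integral 1 u
        = - (u * bessel_integral 2 u)"
      using bessel_integral_ode[of u] by linarith
    moreover have "- (u * bessel_integral 2 u) / sqrt (4 * u + 1) \<le> 0"
      using u pos bessel_integral_2_nonneg[of u] by simp
    ultimately show "\<exists>d. (?H has_real_derivative d) (at u) \<and> d \<le> 0"
      by metis
  qed
  then show ?thesis
    using assms by (simp add: bessel_integral_0_0 field_simps)
qed

section \<open>Moments of the sine\<close>

lemma sin_power_has_integral_step:
  assumes "((\<lambda>\<theta>. sin \<theta> ^ k) has_integral c) {- (pi / 2)..pi / 2}"
  shows "((\<lambda>\<theta>. sin \<theta> ^ (k + 2)) has_integral (k + 1) / (k + 2) * c) {- (pi / 2)..pi / 2}"
proof -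
  let ?I = "{- (pi / 2)..pi / 2}"
  \<comment> \<open>The boundary term of an integration by parts, scaled by \<open>k + 2\<close>;
    its factor \<open>cos \<theta>\<close> makes it vanish at both ends.\<close>
  let ?F = "\<lambda>\<theta>. - (sin \<theta> ^ Suc k * cos \<theta>) / (k + 2)"
  let ?f = "\<lambda>\<theta>. sin \<theta> ^ (k + 2) - (k + 1) / (k + 2) * sin \<theta> ^ k"
  have "(?f has_integral ?F (pi / 2) - ?F (- (pi / 2))) ?I"
  proof (rule fundamental_theorem_of_calculus)
    fix \<theta> :: real
    have "(?F has_real_derivative
        (- (real (Suc k) * sin \<theta> ^ k * cos \<theta> * cos \<theta>) + sin \<theta> ^ Suc k * sin \<theta>) / (k + 2))
        (at \<theta> within ?I)"
      by (rule derivative_eq_intros refl | simp)+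
    moreover have "real (Suc k) * sin \<theta> ^ k * cos \<theta> * cos \<theta>
        = real (Suc k) * sin \<theta> ^ k * (1 - (sin \<theta>)\<^sup>2)"
      by (simp add: mult.assoc flip: cos_squared_eq power2_eq_square)
    then have "(- (real (Suc k) * sin \<theta> ^ k * cos \<theta> * cos \<theta>) + sin \<theta> ^ Suc k * sin \<theta>) / (k + 2) = ?f \<theta>"
      by (simp add: field_simps power2_eq_square)
    ultimately show "(?F has_vector_derivative ?f \<theta>) (at \<theta> within ?I)"
      by (simp add: has_real_derivative_iff_has_vector_derivative)
  qed simp
  from has_integral_add[OF this has_integral_mult_right[OF assms, of "(k + 1) / (k + 2)"]]
  show ?thesis by (simp add: add.commute)
qed

text \<open>Iterating the recursion from the value \<open>pi\<close> gives a product of factors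
  \<open>(2 * i + 1) / (2 * i + 2)\<close>, that is, the central binomial coefficient over
  \<open>4 ^ j\<close>.\<close>

lemma sin_even_power_has_integral:
  "((\<lambda>\<theta>. sin \<theta> ^ (2 * j)) has_integral pi * fact (2 * j) / (4 ^ j * (fact j)\<^sup>2))
    {- (pi / 2)..pi / 2}"
proof (induction j)
  case 0
  show ?case
    using has_integral_const_real[of "1::real" "- (pi / 2)" "pi / 2"] by simp
next
  case (Suc j)
  have "real (2 * j + 1) / real (2 * j + 2) * (pi * fact (2 * j) / (4 ^ j * (fact j)\<^sup>2))
      = pi * fact (2 * Suc j) / (4 ^ Suc j * (fact (Suc j))\<^sup>2)"
    by (simp add: divide_simps power2_eq_square) (simp add: algebra_simps)
  with sin_power_has_integral_step[OF Suc.IH] show ?case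
    by (simp add: add.commute)
qed

text \<open>The same recursion, now started from the integral of \<open>sin\<close>, which is zero,
  so that every later value is zero too.\<close>

lemma sin_odd_power_has_integral:
  "((\<lambda>\<theta>. sin \<theta> ^ (2 * j + 1)) has_integral 0) {- (pi / 2)..pi / 2}"
proof (induction j)
  case 0
  have "(sin has_integral - cos (pi / 2) - - cos (- (pi / 2))) {- (pi / 2)..pi / 2}"
    by (rule fundamental_theorem_of_calculus)
      (auto intro!: derivative_eq_intros simp flip: has_real_derivative_iff_has_vector_derivative)
  then show ?case by simp
next
  case (Suc j)
  from sin_power_has_integral_step[OF this] show ?case
    by (simp add: add.commute)
qed

section \<open>Power series of the integral\<close>

lemma bessel_integral_sums:
  "(\<lambda>j. pi * (exp (- y) * (y ^ j / fact j))\<^sup>2) sums bessel_integral 0 y"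
proof -
  let ?I = "{- (pi / 2)..pi / 2}"
  let ?f = "\<lambda>k \<theta>. exp (- 2 * y) * (- 2 * y) ^ k / fact k * sin \<theta> ^ k"
  let ?c = "\<lambda>k. integral ?I (?f k)"
  have "uniform_limit ?I (\<lambda>N \<theta>. \<Sum>k<N. ?f k \<theta>) (\<lambda>\<theta>. \<Sum>k. ?f k \<theta>) sequentially"
  proof (rule Weierstrass_m_test)
    \<comment> \<open>By \<open>\<bar>sin \<theta>\<bar> \<le> 1\<close>, the exponential series at
      \<open>\<bar>2 * y\<bar>\<close> is a majorant independent of \<open>\<theta>\<close>; the
      resulting uniform convergence permits integration term by term.\<close>
    show "norm (?f k \<theta>) \<le> exp (- 2 * y) * (\<bar>2 * y\<bar> ^ k /\<^sub>R fact k)" for k \<theta>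
    proof -
      have "\<bar>sin \<theta>\<bar> ^ k \<le> 1"
        by (intro power_le_one) auto
      then have "exp (- 2 * y) * \<bar>2 * y\<bar> ^ k / fact k * \<bar>sin \<theta>\<bar> ^ k
          \<le> exp (- 2 * y) * \<bar>2 * y\<bar> ^ k / fact k"
        by (intro mult_left_le) auto
      then show ?thesis
        by (simp add: abs_mult power_abs divide_inverse mult_ac)
    qed
    show "summable (\<lambda>k. exp (- 2 * y) * (\<bar>2 * y\<bar> ^ k /\<^sub>R fact k))"
      by (intro summable_mult summable_exp_generic)
  qed
  moreover have "(\<Sum>k. ?f k \<theta>) = bessel_integrand 0 y \<theta>" for \<theta>
  proof -
    \<comment> \<open>Only the factor \<open>exp (- 2 * y * sin \<theta>)\<close> is expanded, so
      that pure powers of \<open>sin \<theta>\<close> appear.\<close>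
    have "(\<lambda>k. exp (- 2 * y) * ((- 2 * y * sin \<theta>) ^ k /\<^sub>R fact k)) sums
        (exp (- 2 * y) * exp (- 2 * y * sin \<theta>))"
      by (intro sums_mult exp_converges)
    moreover have "exp (- 2 * y) * ((- 2 * y * sin \<theta>) ^ k /\<^sub>R fact k) = ?f k \<theta>" for k
      by (simp only: power_mult_distrib real_scaleR_def divide_inverse mult_ac)
    ultimately have "(\<lambda>k. ?f k \<theta>) sums (exp (- 2 * y) * exp (- 2 * y * sin \<theta>))"
      by (simp only:)
    then show ?thesis
      by (simp add: sums_iff bessel_integrand_def algebra_simps flip: exp_add)
  qed
  ultimately have "uniform_limit ?I (\<lambda>N \<theta>. \<Sum>k<N. ?f k \<theta>) (bessel_integrand 0 y) sequentially"
    by simp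
  \<comment> \<open>\<open>A\<close> and \<open>B\<close> arrive as unspecified values; uniqueness
    of the integral identifies them below.\<close>
  then obtain A B where AB: "\<And>N. ((\<lambda>\<theta>. \<Sum>k<N. ?f k \<theta>) has_integral A N) ?I"
      "(bessel_integrand 0 y has_integral B) ?I" "A \<longlonglongrightarrow> B"
    by (rule uniform_limit_integral) (auto intro!: continuous_intros)
  have "A = (\<lambda>N. \<Sum>k<N. ?c k)"
  proof
    fix N
    have "((\<lambda>\<theta>. \<Sum>k<N. ?f k \<theta>) has_integral (\<Sum>k<N. ?c k)) ?I"
      by (intro has_integral_sum integrable_integral integrable_continuous_real continuous_intros)
        auto
    with AB(1)[of N] show "A N = (\<Sum>k<N. ?c k)" by (rule has_integral_unique)
  qed
  moreover have "B = bessel_integral 0 y"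
    using AB(2) bessel_integral_has_integral by (rule has_integral_unique)
  ultimately have "?c sums bessel_integral 0 y"
    using AB(3) by (simp only: sums_def)
  \<comment> \<open>Odd moments vanish, so the series can be reindexed along the even
    \<open>k\<close>.\<close>
  moreover have "?c k = 0" if "k \<notin> range (\<lambda>j. 2 * j)" for k
  proof -
    have "odd k" using that by (auto elim: evenE)
    then obtain j where "k = 2 * j + 1" by (rule oddE)
    then show ?thesis
      using sin_odd_power_has_integral[of j] by (simp add: has_integral_iff)
  qed
  ultimately have "(\<lambda>j. ?c (2 * j)) sums bessel_integral 0 y"
    by (subst sums_mono_reindex) (auto simp: strict_mono_def)
  moreover have "?c (2 * j) = pi * (exp (- y) * (y ^ j / fact j))\<^sup>2" for j
  proof -
    have e: "exp (- 2 * y) = (exp (- y))\<^sup>2"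
      by (simp flip: exp_double)
    have p: "(- 2 * y) ^ (2 * j) = 4 ^ j * (y ^ j)\<^sup>2"
      by (simp add: power_mult power_mult_distrib) (simp add: mult.commute flip: power_mult)
    \<comment> \<open>The moment contributes \<open>fact (2 * j)\<close> and \<open>4 ^ j\<close>,
      which cancel against the coefficient and leave a square.\<close>
    have "?c (2 * j) = exp (- 2 * y) * (- 2 * y) ^ (2 * j) / fact (2 * j)
        * (pi * fact (2 * j) / (4 ^ j * (fact j)\<^sup>2))"
      using sin_even_power_has_integral[of j] by (simp add: has_integral_iff)
    also have "\<dots> = pi * (exp (- y) * (y ^ j / fact j))\<^sup>2"
      unfolding e p by (simp add: power_mult_distrib power_divide)
    finally show ?thesis .
  qed
  ultimately show ?thesis by simp
qed

lemma K_eq_bessel_integral: "K n x = bessel_integral 0 (n * x) / pi"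
  using sums_mult[OF bessel_integral_sums[of "n * x"], of "1 / pi"]
  unfolding K_def by (simp add: sums_iff)

section \<open>Substitution of the arcsine\<close>

lemma arcsin_substitution_has_integral:
  "((\<lambda>t. exp (- 2 * y * (1 + t)) * (1 / sqrt (1 - t\<^sup>2))) has_integral bessel_integral 0 y) {-1..1}"
proof -
  have "((\<lambda>t. inverse (sqrt (1 - t\<^sup>2)) *\<^sub>R bessel_integrand 0 y (arcsin t)) has_integral
      integral {arcsin (- 1)..arcsin 1} (bessel_integrand 0 y)) {-1..1}"
  \<comment> \<open>The derivative of \<open>arcsin\<close> blows up at \<open>-1\<close> and
    \<open>1\<close>; these form the exceptional set \<open>s\<close>, where continuity of
    \<open>arcsin\<close> suffices.\<close>
  proof (rule has_integral_substitution_strong[where g = arcsin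
        and g' = "\<lambda>t. inverse (sqrt (1 - t\<^sup>2))" and f = "bessel_integrand 0 y"
        and s = "{-1, 1}" and c = "- (pi / 2)" and d = "pi / 2"])
    show "arcsin ` {-1..1} \<subseteq> {- (pi / 2)..pi / 2}"
      using arcsin_bounded by (simp add: image_subset_iff)
    show "continuous_on {- (pi / 2)..pi / 2} (bessel_integrand 0 y)"
      by (rule continuous_on_bessel_integrand)
    show "(arcsin has_real_derivative inverse (sqrt (1 - t\<^sup>2))) (at t within {-1..1})"
      if "t \<in> {-1..1} - {-1, 1}" for t
      using that by (auto intro: has_field_derivative_at_within[OF DERIV_arcsin])
  qed (auto intro: continuous_on_arcsin')
  then have "((\<lambda>t. inverse (sqrt (1 - t\<^sup>2)) *\<^sub>R bessel_integrand 0 y (arcsin t)) has_integral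
      bessel_integral 0 y) {-1..1}"
    by (simp add: bessel_integral_def)
  then show ?thesis
    by (rule has_integral_eq[rotated]) (auto simp: bessel_integrand_def divide_inverse)
qed

section \<open>Transfer from the integral to \<open>K\<close> along \<open>y = n * x\<close>\<close>

theorem theorem6p1:
  fixes n :: real
  assumes "n > 0"
  shows "(\<exists>K' K''. \<forall>x\<ge>0.
           (K n has_real_derivative K' x) (at x within {0..}) \<and>
           (K' has_real_derivative K'' x) (at x within {0..}) \<and>
           x * K'' x + (4 * n * x + 1) * K' x + 2 * n * K n x = 0) \<and>
         (\<forall>x\<ge>0.
           (\<lambda>t. exp (- 2 * n * x * (1 + t)) * (1 / sqrt (1 - t\<^sup>2))) integrable_on {-1..1} \<and>
           K n x = 1 / pi *
             integral {-1..1} (\<lambda>t. exp (- 2 * n * x * (1 + t)) * (1 / sqrt (1 - t\<^sup>2)))) \<and>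
         (\<forall>x\<ge>0. K n x \<le> 1 / sqrt (4 * n * x + 1))"
proof (intro conjI)
  have K_eq: "K n = (\<lambda>x. bessel_integral 0 (n * x) / pi)"
    by (rule ext) (rule K_eq_bessel_integral)
  \<comment> \<open>The chain rule yields one factor \<open>n\<close> per derivative; an arbitrary
    \<open>A\<close> covers the one-sided derivative at \<open>0\<close>.\<close>
  have deriv: "((\<lambda>x. n ^ m * bessel_integral m (n * x) / pi) has_real_derivative
      n ^ Suc m * bessel_integral (Suc m) (n * x) / pi) (at x within A)" for m x A
    by (auto intro!: derivative_eq_intros DERIV_chain2[OF DERIV_bessel_integral])
  show "\<exists>K' K''. \<forall>x\<ge>0.
      (K n has_real_derivative K' x) (at x within {0..}) \<and>
      (K' has_real_derivative K'' x) (at x within {0..}) \<and>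
      x * K'' x + (4 * n * x + 1) * K' x + 2 * n * K n x = 0"
  proof (intro exI allI impI conjI)
    fix x :: real
    show "(K n has_real_derivative n ^ 1 * bessel_integral 1 (n * x) / pi) (at x within {0..})"
      using deriv[of 0 x] by (simp add: K_eq)
    show "((\<lambda>x. n ^ 1 * bessel_integral 1 (n * x) / pi) has_real_derivative
        n ^ 2 * bessel_integral 2 (n * x) / pi) (at x within {0..})"
      using deriv[of 1 x] by (simp add: numeral_2_eq_2)
    \<comment> \<open>The equation in \<open>x\<close> is \<open>n / pi\<close> times the one for
      the integral at \<open>n * x\<close>.\<close>
    have "x * (n ^ 2 * bessel_integral 2 (n * x) / pi)
        + (4 * n * x + 1) * (n ^ 1 * bessel_integral 1 (n * x) / pi) + 2 * n * K n x
        = n / pi * (n * x * bessel_integral 2 (n * x)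
        + (4 * (n * x) + 1) * bessel_integral 1 (n * x) + 2 * bessel_integral 0 (n * x))"
      by (simp add: K_eq field_simps power2_eq_square)
    then show "x * (n ^ 2 * bessel_integral 2 (n * x) / pi)
        + (4 * n * x + 1) * (n ^ 1 * bessel_integral 1 (n * x) / pi) + 2 * n * K n x = 0"
      by (simp only: bessel_integral_ode mult_zero_right)
  qed
  show "\<forall>x\<ge>0.
      (\<lambda>t. exp (- 2 * n * x * (1 + t)) * (1 / sqrt (1 - t\<^sup>2))) integrable_on {-1..1} \<and>
      K n x = 1 / pi *
        integral {-1..1} (\<lambda>t. exp (- 2 * n * x * (1 + t)) * (1 / sqrt (1 - t\<^sup>2)))"
    using arcsin_substitution_has_integral[of "n * x" for x]
    by (simp add: K_eq has_integral_iff mult.assoc)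
  show "\<forall>x\<ge>0. K n x \<le> 1 / sqrt (4 * n * x + 1)"
  proof (intro allI impI)
    fix x :: real assume "x \<ge> 0"
    then have "bessel_integral 0 (n * x) \<le> pi / sqrt (4 * (n * x) + 1)"
      using assms by (intro bessel_integral_le) simp
    then have "bessel_integral 0 (n * x) / pi \<le> pi / sqrt (4 * (n * x) + 1) / pi"
      by (rule divide_right_mono) simp
    then show "K n x \<le> 1 / sqrt (4 * n * x + 1)"
      by (simp add: K_eq mult.assoc)
  qed
qed

end
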